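(* Let $\nu$ be a conical $n$-uniform measure in $\mathbb{R}^d$ and let $\Sigma$ be its support. Then $\Sigma$ is an algebraic variety (in $\mathbb{R}^d$) and $$\Sigma=-\Sigma.$$
   Context: $B(x,r)$ is the open Euclidean ball in $\mathbb{R}^d$. All measures are Radon measures. The support of a measure $\nu$ is $\mathrm{supp}(\nu)=\{x\in\mathbb{R}^d:\nu(B(x,r))>0\text{ for all }r>0\}$. $\nu$ is $n$-uniform if there is a constant $c>0$ with $\nu(B(x,r))=c\,r^n$ for all $x\in\mathrm{supp}(\nu)$ and all $r>0$. It is a conical $n$-uniform measure if in addition $T_{0,r}[\nu]=r^n\nu$ for all $r>0$, where $T_{0,r}[\nu](A)=\nu(rA)$. An algebraic variety in $\mathbb{R}^d$ is the common zero set in $\mathbb{R}^d$ of a family of real polynomials. $-\Sigma=\{-x:x\in\Sigma\}$. *)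

theory Defs
  imports "HOL-Analysis.Analysis"
begin

text \<open>On \<open>\<real>\<^sup>d\<close> the two regularity conditions follow from finiteness on compact sets; they are
  kept so that the definition is the usual one.\<close>

definition radon_measure :: "'a::topological_space measure \<Rightarrow> bool" where
  "radon_measure \<nu> \<longleftrightarrow>
     sets \<nu> = sets borel \<and>
     (\<forall>K. compact K \<longrightarrow> emeasure \<nu> K < \<infinity>) \<and>
     (\<forall>A\<in>sets borel. emeasure \<nu> A = (INF U\<in>{U. open U \<and> A \<subseteq> U}. emeasure \<nu> U)) \<and>
     (\<forall>U. open U \<longrightarrow> emeasure \<nu> U = (SUP K\<in>{K. compact K \<and> K \<subseteq> U}. emeasure \<nu> K))"

definition msupport :: "'a::metric_space measure \<Rightarrow> 'a set" where
  "msupport \<nu> = {x. \<forall>r>0. emeasure \<nu> (ball x r) > 0}"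

definition uniform_measure_dim :: "nat \<Rightarrow> 'a::metric_space measure \<Rightarrow> bool" where
  "uniform_measure_dim n \<nu> \<longleftrightarrow> radon_measure \<nu> \<and>
     (\<exists>c::real. c > 0 \<and> (\<forall>x\<in>msupport \<nu>. \<forall>r>0. emeasure \<nu> (ball x r) = ennreal (c * r ^ n)))"

text \<open>The measure \<open>T\<^sub>0\<^sub>,\<^sub>r[\<nu>]\<close>; the lemma below is its defining property \<open>A \<mapsto> \<nu>(rA)\<close>.\<close>

definition dilated_measure :: "real \<Rightarrow> 'a::real_normed_vector measure \<Rightarrow> 'a measure" where
  "dilated_measure r \<nu> = distr \<nu> borel (\<lambda>x. x /\<^sub>R r)"

lemma emeasure_dilated_measure:
  fixes \<nu> :: "'a::real_normed_vector measure"
  assumes "sets \<nu> = sets borel" and "r > 0" and "A \<in> sets borel"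
  shows "emeasure (dilated_measure r \<nu>) A = emeasure \<nu> ((*\<^sub>R) r ` A)"
proof -
  have sp: "space \<nu> = UNIV"
    using sets_eq_imp_space_eq[OF assms(1)] by simp
  have "(\<lambda>x::'a. x /\<^sub>R r) \<in> borel_measurable borel"
    by (intro borel_measurable_continuous_onI continuous_intros)
  then have m: "(\<lambda>x::'a. x /\<^sub>R r) \<in> measurable \<nu> borel"
    using measurable_cong_sets[OF assms(1) refl] by blast
  have "(\<lambda>x. x /\<^sub>R r) -` A = (*\<^sub>R) r ` A"
    using assms(2) by (force simp: image_iff)
  then show ?thesis
    unfolding dilated_measure_def using emeasure_distr[OF m assms(3)] sp by simp
qed

definition conical_uniform_measure :: "nat \<Rightarrow> 'a::real_normed_vector measure \<Rightarrow> bool" where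
  "conical_uniform_measure n \<nu> \<longleftrightarrow> uniform_measure_dim n \<nu> \<and>
     (\<forall>r>0. dilated_measure r \<nu> = scale_measure (ennreal (r ^ n)) \<nu>)"

text \<open>On \<open>\<real>\<^sup>d\<close> the predicate \<^const>\<open>real_polynomial_function\<close> holds exactly for the real polynomials
  in the coordinates: it is the closure of the linear functionals and the constants under sums
  and products. The family \<open>F\<close> may be infinite or empty.\<close>

definition algebraic_variety :: "'a::euclidean_space set \<Rightarrow> bool" where
  "algebraic_variety S \<longleftrightarrow>
     (\<exists>F. (\<forall>p\<in>F. real_polynomial_function p) \<and> S = {x. \<forall>p\<in>F. p x = 0})"

end

theory Submission
  imports Defs "HOL-Complex_Analysis.Complex_Analysis" "HOL-Real_Asymp.Real_Asymp"
begin

text \<open>Write \<open>I x\<close> for the integral of \<open>exp (- |z - x|\<^sup>2)\<close> over \<open>\<nu>\<close>. On the support \<open>\<Sigma>\<close> the value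
  \<open>I x\<close> depends only on the measures of the balls around \<open>x\<close>, so \<open>I x = I 0\<close>; since \<open>\<Sigma>\<close> is a
  cone, \<open>I (t x) = I 0\<close> for all \<open>t > 0\<close>. Conversely, if \<open>I (t x) = I 0\<close> for all \<open>t > 0\<close>, then by
  conicality the integral of \<open>exp (- |z - x|\<^sup>2 / r\<^sup>2)\<close> is \<open>r\<^sup>n I 0\<close>, which does not decay fast enough
  as \<open>r \<rightarrow> 0\<close> for \<open>\<nu>\<close> to vanish near \<open>x\<close>; so \<open>x \<in> \<Sigma>\<close>. Expanding \<open>exp (t\<^sup>2 |x|\<^sup>2) (I (t x) - I 0)\<close>
  in powers of \<open>t\<close>, the coefficient of \<open>t\<^sup>k\<close> is a homogeneous polynomial of degree \<open>k\<close> in \<open>x\<close>.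
  Hence \<open>\<Sigma>\<close> is the common zero set of homogeneous polynomials, and such a set is symmetric.\<close>

section \<open>Moments, integrability and power series for general measures\<close>

text \<open>Induction on \<open>k\<close> with the weight \<open>g\<close> arbitrary: one factor
  \<open>x \<bullet> z\<close> is expanded in coordinates, and each \<open>z \<bullet> b\<close> is
  absorbed into the weight. Assuming all moments of \<open>g\<close> finite makes the new weight
  admissible again.\<close>

lemma real_polynomial_function_inner_moment:
  fixes g :: "'a::euclidean_space \<Rightarrow> real"
  assumes sets: "sets M = sets borel" and g: "g \<in> borel_measurable borel"
    and int: "\<And>k. integrable M (\<lambda>z. norm z ^ k * g z)"
  shows "real_polynomial_function (\<lambda>x. \<integral>z. (x \<bullet> z) ^ k * g z \<partial>M)"
  using g int
proof (induction k arbitrary: g)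
  case 0
  then show ?case by (simp add: real_polynomial_function.intros(2))
next
  case (Suc k)
  note [measurable_cong] = sets
  note [measurable] = Suc.prems(1)
  have intb: "integrable M (\<lambda>z. norm z ^ j * ((z \<bullet> b) * g z))" if "b \<in> Basis" for j b
  proof (rule Bochner_Integration.integrable_bound[OF Suc.prems(2)[of "Suc j"]])
    have "\<bar>z \<bullet> b\<bar> * \<bar>norm z ^ j * g z\<bar> \<le> norm z * \<bar>norm z ^ j * g z\<bar>" for z
      using Basis_le_norm[OF that] by (rule mult_right_mono) simp
    then show "AE z in M. norm (norm z ^ j * ((z \<bullet> b) * g z)) \<le> norm (norm z ^ Suc j * g z)"
      by (intro AE_I2) (simp add: abs_mult mult_ac)
  qed measurable
  have intx: "integrable M (\<lambda>z. (x \<bullet> z) ^ k * ((z \<bullet> b) * g z))" if "b \<in> Basis" for x b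
  proof (rule Bochner_Integration.integrable_bound)
    show "integrable M (\<lambda>z. norm x ^ k * (norm z ^ k * ((z \<bullet> b) * g z)))"
      using intb[OF that] by (rule integrable_mult_right)
    have "\<bar>x \<bullet> z\<bar> ^ k \<le> norm x ^ k * norm z ^ k" for z
      using power_mono[OF Cauchy_Schwarz_ineq2[of x z], of k] by (simp add: power_mult_distrib)
    then have "\<bar>x \<bullet> z\<bar> ^ k * \<bar>(z \<bullet> b) * g z\<bar> \<le> (norm x ^ k * norm z ^ k) * \<bar>(z \<bullet> b) * g z\<bar>" for z
      by (rule mult_right_mono) simp
    then show "AE z in M. norm ((x \<bullet> z) ^ k * ((z \<bullet> b) * g z))
        \<le> norm (norm x ^ k * (norm z ^ k * ((z \<bullet> b) * g z)))"
      by (intro AE_I2) (simp add: abs_mult power_abs mult.assoc)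
  qed measurable
  have "(\<integral>z. (x \<bullet> z) ^ Suc k * g z \<partial>M) =
      (\<Sum>b\<in>Basis. (x \<bullet> b) * (\<integral>z. (x \<bullet> z) ^ k * ((z \<bullet> b) * g z) \<partial>M))" for x
  proof -
    have "(x \<bullet> z) ^ Suc k * g z =
        (\<Sum>b\<in>Basis. (x \<bullet> b) * ((x \<bullet> z) ^ k * ((z \<bullet> b) * g z)))" for z
      by (simp add: euclidean_inner[of x z] sum_distrib_left sum_distrib_right mult_ac)
    then show ?thesis
      using intx by simp
  qed
  moreover have "real_polynomial_function
      (\<lambda>x. (x \<bullet> b) * (\<integral>z. (x \<bullet> z) ^ k * ((z \<bullet> b) * g z) \<partial>M))" if "b \<in> Basis" for b :: 'a
    using that intb
    by (intro real_polynomial_function.intros(4) real_polynomial_function.intros(1)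
        bounded_linear_inner_left Suc.IH) auto
  ultimately show ?case
    by (simp only:) (intro real_polynomial_function_sum, auto)
qed

text \<open>On the shell \<open>k \<le> norm z < k + 1\<close> the integrand is at most
  \<open>exp (- k)\<close>, while the mass of the shell grows only polynomially in
  \<open>k\<close>.\<close>

lemma integrable_exp_neg_norm:
  fixes M :: "'a::euclidean_space measure"
  assumes sets: "sets M = sets borel"
    and growth: "\<And>r. r > 0 \<Longrightarrow> emeasure M (ball 0 r) \<le> ennreal (c * r ^ n)" and "c \<ge> 0"
  shows "integrable M (\<lambda>z. exp (- norm z))"
proof (rule integrableI_bounded)
  note [measurable_cong] = sets
  \<comment> \<open>The whole ball of radius \<open>k + 1\<close> replaces the shell; this still
    dominates, and its mass is controlled by \<open>growth\<close>.\<close>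
  let ?h = "\<lambda>k z. ennreal (exp (- real k)) * indicator (ball 0 (real (Suc k))) (z::'a)"
  let ?s = "\<lambda>k. exp (- real k) * (c * real (Suc k) ^ n)"
  show "(\<lambda>z. exp (- norm z)) \<in> borel_measurable M" by measurable
  \<comment> \<open>Half of the exponent absorbs the polynomial factor; the other half leaves a
    geometric series.\<close>
  have "summable (\<lambda>k. norm (exp (- real k / 2)))"
    using summable_geometric[of "exp (- 1 / 2 :: real)"]
    by (simp add: exp_of_nat_mult[symmetric] mult.commute[of _ "real _"])
  moreover have "(\<lambda>k. real (Suc k) ^ n * exp (- real k)) \<in> O(\<lambda>k. exp (- real k / 2))"
    by real_asymp
  ultimately have "summable (\<lambda>k. real (Suc k) ^ n * exp (- real k))"
    by (rule summable_comparison_test_bigo)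
  then have summ: "summable ?s"
    using summable_mult[of "\<lambda>k. real (Suc k) ^ n * exp (- real k)" c] by (simp add: mult_ac)
  have le: "ennreal (exp (- norm z)) \<le> (\<Sum>k. ?h k z)" for z
  proof -
    define k where "k = nat \<lfloor>norm z\<rfloor>"
    have k: "real k \<le> norm z" "norm z < real (Suc k)"
      unfolding k_def by (auto, linarith)
    then have "ennreal (exp (- norm z)) \<le> ?h k z"
      by (auto simp: indicator_def intro: ennreal_leI)
    also have "\<dots> \<le> (\<Sum>k. ?h k z)"
      using sum_le_suminf[OF summableI, of "{k}" "\<lambda>k. ?h k z"]
      by (simp only: sum.insert sum.empty finite.intros empty_iff not_False_eq_True add_0_right
          zero_le simp_thms)
    finally show ?thesis .
  qed
  have "(\<integral>\<^sup>+z. ennreal (norm (exp (- norm z))) \<partial>M) \<le> (\<integral>\<^sup>+z. (\<Sum>k. ?h k z) \<partial>M)"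
    using le by (intro nn_integral_mono) simp
  also have "\<dots> = (\<Sum>k. \<integral>\<^sup>+z. ?h k z \<partial>M)"
    by (intro nn_integral_suminf borel_measurable_times_ennreal borel_measurable_const
        borel_measurable_indicator) (simp add: sets)
  also have "\<dots> \<le> (\<Sum>k. ennreal (?s k))"
  proof (rule suminf_le)
    fix k
    have "(\<integral>\<^sup>+z. ?h k z \<partial>M) = ennreal (exp (- real k)) * emeasure M (ball 0 (real (Suc k)))"
      by (rule nn_integral_cmult_indicator) (simp add: sets)
    also have "\<dots> \<le> ennreal (exp (- real k)) * ennreal (c * real (Suc k) ^ n)"
      using growth by (intro mult_left_mono) auto
    also have "\<dots> = ennreal (?s k)"
      using \<open>c \<ge> 0\<close> by (simp add: ennreal_mult)
    finally show "(\<integral>\<^sup>+z. ?h k z \<partial>M) \<le> ennreal (?s k)" .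
  qed (auto intro: summableI)
  also have "\<dots> = ennreal (\<Sum>k. ?s k)"
    using \<open>c \<ge> 0\<close> summ by (intro suminf_ennreal2) auto
  finally show "(\<integral>\<^sup>+z. ennreal (norm (exp (- norm z))) \<partial>M) < \<infinity>"
    using le_less_trans by fastforce
qed

text \<open>Indexing by powers of \<open>s\<close> rather than of \<open>s\<^sup>2\<close> allows
  termwise subtraction from the moment series.\<close>

lemma sums_exp_square:
  fixes s :: real
  shows "(\<lambda>k. if even k then s ^ k / fact (k div 2) else 0) sums exp (s\<^sup>2)"
proof -
  have "(\<lambda>j. (s\<^sup>2) ^ j /\<^sub>R fact j) sums exp (s\<^sup>2)"
    by (rule exp_converges)
  from sums_if[OF sums_zero this]
  have "(\<lambda>k. if even k then (s\<^sup>2) ^ (k div 2) /\<^sub>R fact (k div 2) else 0) sums exp (s\<^sup>2)"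
    by simp
  also have "(\<lambda>k. if even k then (s\<^sup>2) ^ (k div 2) /\<^sub>R fact (k div 2) else 0) =
      (\<lambda>k. if even k then s ^ k / fact (k div 2) else 0)"
    by (auto simp: fun_eq_iff power_mult[symmetric] divide_inverse mult.commute)
  finally show ?thesis .
qed

text \<open>A power series with a nonzero coefficient has isolated zeros, whereas the zeros of
  \<open>f\<close> accumulate at 0. The condition \<open>a 0 = 0\<close> makes 0 itself a zero of
  \<open>f\<close>.\<close>

lemma power_series_eq_0:
  fixes a :: "nat \<Rightarrow> real"
  assumes sums: "\<And>t. (\<lambda>k. a k * t ^ k) sums f t" and "a 0 = 0"
    and zero: "\<And>t. t > 0 \<Longrightarrow> f t = 0"
  shows "a k = 0"
proof (rule ccontr)
  assume "a k \<noteq> 0"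
  then have "k > 0" using \<open>a 0 = 0\<close> by (cases k) auto
  have "f 0 = 0"
    using sums_unique2[OF sums[of 0] powser_sums_zero[of a]] \<open>a 0 = 0\<close> by simp
  obtain s where "s > 0" "\<And>t. t \<in> cball 0 s - {0} \<Longrightarrow> f t \<noteq> 0"
    using powser_0_nonzero[of 1 0 a f k] sums \<open>f 0 = 0\<close> \<open>a k \<noteq> 0\<close> \<open>k > 0\<close> by auto
  then have "f s \<noteq> 0" by auto
  with zero \<open>s > 0\<close> show False by simp
qed

section \<open>The support as a cone, and Gaussian integrals over it\<close>

locale conical_uniform =
  fixes M :: "'a::euclidean_space measure" and n :: nat and c :: real
  assumes sets_M: "sets M = sets borel"
    and c_pos: "c > 0"
    and emeasure_ball: "x \<in> msupport M \<Longrightarrow> r > 0 \<Longrightarrow> emeasure M (ball x r) = ennreal (c * r ^ n)"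
    and dilated: "r > 0 \<Longrightarrow> dilated_measure r M = scale_measure (ennreal (r ^ n)) M"
    and msupport_nonempty: "msupport M \<noteq> {}"
begin

lemmas [measurable_cong] = sets_M

definition gauss_int :: "'a \<Rightarrow> real" where
  "gauss_int x = (\<integral>z. exp (- (norm (z - x))\<^sup>2) \<partial>M)"

text \<open>Up to the factor \<open>2 ^ k / fact k\<close>, this is the degree \<open>k\<close> term
  of \<open>exp (2 * (x \<bullet> z))\<close> integrated against the Gaussian weight.\<close>

definition moment :: "nat \<Rightarrow> 'a \<Rightarrow> real" where
  "moment k x = (\<integral>z. (x \<bullet> z) ^ k * exp (- (norm z)\<^sup>2) \<partial>M)"

text \<open>The coefficient of \<open>t\<^sup>k\<close> in \<open>exp (t\<^sup>2 |x|\<^sup>2) * (gauss_int (t x) - gauss_int 0)\<close>.\<close>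

definition taylor_coeff :: "nat \<Rightarrow> 'a \<Rightarrow> real" where
  "taylor_coeff k x = 2 ^ k / fact k * moment k x
     - gauss_int 0 * (if even k then norm x ^ k / fact (k div 2) else 0)"

lemma emeasure_ball_scale:
  assumes "r > 0"
  shows "emeasure M (ball (r *\<^sub>R x) (r * e)) = ennreal (r ^ n) * emeasure M (ball x e)"
proof -
  have "emeasure M (ball (r *\<^sub>R x) (r * e)) = emeasure (dilated_measure r M) (ball x e)"
    using assms by (subst emeasure_dilated_measure[OF sets_M]) (auto simp: ball_scale)
  then show ?thesis
    using dilated[OF assms] by simp
qed

lemma scaleR_in_msupport:
  assumes "x \<in> msupport M" "r > 0"
  shows "r *\<^sub>R x \<in> msupport M"
  unfolding msupport_def
proof safe
  fix e :: real assume "e > 0"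
  then show "emeasure M (ball (r *\<^sub>R x) e) > 0"
    using emeasure_ball_scale[of r x "e / r"] assms c_pos
    by (simp add: emeasure_ball ennreal_mult[symmetric])
qed

text \<open>Points of the support can be shrunk towards the origin without leaving the
  support.\<close>

lemma zero_in_msupport: "0 \<in> msupport M"
  unfolding msupport_def
proof safe
  fix e :: real assume "e > 0"
  obtain x where x: "x \<in> msupport M" using msupport_nonempty by auto
  \<comment> \<open>This makes \<open>norm (t *\<^sub>R x) \<le> e / 2\<close>; the summand 1 keeps
    the denominator positive when \<open>x = 0\<close>.\<close>
  define t where "t = e / (2 * (norm x + 1))"
  have "t > 0"
    using \<open>e > 0\<close> unfolding t_def by (intro divide_pos_pos) (auto intro: add_nonneg_pos)
  have "t * (norm x + 1) = e / 2"
    unfolding t_def by (simp add: field_simps add_nonneg_eq_0_iff)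
  then have "t * norm x \<le> e / 2"
    using \<open>t > 0\<close> by (simp add: algebra_simps)
  then have "ball (t *\<^sub>R x) (e / 2) \<subseteq> ball 0 e"
    using \<open>t > 0\<close> by (intro ball_subset_ball_iff[THEN iffD2]) auto
  then have "emeasure M (ball (t *\<^sub>R x) (e / 2)) \<le> emeasure M (ball 0 e)"
    by (intro emeasure_mono) (auto simp: sets_M)
  moreover have "emeasure M (ball (t *\<^sub>R x) (e / 2)) > 0"
    using scaleR_in_msupport[OF x \<open>t > 0\<close>] \<open>e > 0\<close> unfolding msupport_def by simp
  ultimately show "emeasure M (ball 0 e) > 0" by order
qed

text \<open>The distribution of the distance to \<open>x\<close> is the same for all \<open>x\<close> in the support; the minus
  sign turns balls into the half-lines \<open>{s<..}\<close>.\<close>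

lemma gauss_int_msupport:
  assumes x: "x \<in> msupport M"
  shows "gauss_int x = gauss_int 0"
proof -
  have half: "emeasure (distr M borel (\<lambda>z. - dist y z)) {s<..} =
      (if s < 0 then ennreal (c * (- s) ^ n) else 0)" if "y \<in> msupport M" for y s
  proof -
    have "(\<lambda>z. - dist y z) -` {s<..} \<inter> space M = ball y (- s)"
      using sets_eq_imp_space_eq[OF sets_M] by auto
    then have "emeasure (distr M borel (\<lambda>z. - dist y z)) {s<..} = emeasure M (ball y (- s))"
      by (subst emeasure_distr) auto
    then show ?thesis
      using emeasure_ball[OF that, of "- s"] by (auto simp: ball_empty)
  qed
  \<comment> \<open>Agreement on open half-lines suffices because their masses are finite by
    \<open>half\<close>.\<close>
  have eq: "distr M borel (\<lambda>z. - dist x z) = distr M borel (\<lambda>z. - dist 0 z)"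
    by (rule measure_eqI_lessThan) (simp_all add: half[OF x] half[OF zero_in_msupport] del: dist_0_norm)
  have "gauss_int y = (\<integral>s. exp (- s\<^sup>2) \<partial>distr M borel (\<lambda>z. - dist y z))" for y
    unfolding gauss_int_def by (subst integral_distr) (auto simp: dist_norm norm_minus_commute)
  then show ?thesis
    using eq by simp
qed

section \<open>Integrability against the Gaussian weight\<close>

text \<open>Completing the square bounds \<open>a * s - s\<^sup>2\<close> by a constant minus
  \<open>s\<close>, which reduces the claim to \<open>exp (- norm z)\<close>.\<close>

lemma integrable_exp_norm_gauss: "integrable M (\<lambda>z. exp (a * norm z) * exp (- (norm z)\<^sup>2))"
proof (rule Bochner_Integration.integrable_bound)
  have "integrable M (\<lambda>z. exp (- norm z))"
    using c_pos by (intro integrable_exp_neg_norm[OF sets_M, of c n])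
      (auto simp: emeasure_ball[OF zero_in_msupport])
  then show "integrable M (\<lambda>z. exp (((a + 1) / 2)\<^sup>2) * exp (- norm z))"
    by (rule integrable_mult_right)
  have "a * s - s\<^sup>2 \<le> ((a + 1) / 2)\<^sup>2 - s" for s :: real
    using zero_le_power2[of "s - (a + 1) / 2"] by (simp add: power2_eq_square field_simps)
  then show "AE z in M. norm (exp (a * norm z) * exp (- (norm z)\<^sup>2))
      \<le> norm (exp (((a + 1) / 2)\<^sup>2) * exp (- norm z))"
    by (intro AE_I2) (simp add: exp_add[symmetric])
qed measurable

lemma integrable_norm_power_gauss: "integrable M (\<lambda>z. norm z ^ k * exp (- (norm z)\<^sup>2))"
proof (rule Bochner_Integration.integrable_bound)
  show "integrable M (\<lambda>z. fact k * (exp (1 * norm z) * exp (- (norm z)\<^sup>2)))"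
    by (intro integrable_mult_right integrable_exp_norm_gauss)
  \<comment> \<open>A single term of the exponential series is at most its sum.\<close>
  have "norm z ^ k \<le> fact k * exp (norm z)" for z :: 'a
  proof -
    have "(\<Sum>j\<in>{k}. norm z ^ j /\<^sub>R fact j) \<le> (\<Sum>j. norm z ^ j /\<^sub>R fact j)"
      by (rule sum_le_suminf) (auto intro!: summable_exp_generic scaleR_nonneg_nonneg simp del: real_scaleR_def)
    then show ?thesis
      by (simp add: exp_def field_simps)
  qed
  then show "AE z in M. norm (norm z ^ k * exp (- (norm z)\<^sup>2))
      \<le> norm (fact k * (exp (1 * norm z) * exp (- (norm z)\<^sup>2)))"
    by (intro AE_I2) (simp add: mult.assoc[symmetric])
qed measurable

lemma integrable_moment: "integrable M (\<lambda>z. (x \<bullet> z) ^ k * exp (- (norm z)\<^sup>2))"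
proof (rule Bochner_Integration.integrable_bound)
  show "integrable M (\<lambda>z. norm x ^ k * (norm z ^ k * exp (- (norm z)\<^sup>2)))"
    by (intro integrable_mult_right integrable_norm_power_gauss)
  have "\<bar>x \<bullet> z\<bar> ^ k \<le> norm x ^ k * norm z ^ k" for z
    using power_mono[OF Cauchy_Schwarz_ineq2[of x z], of k] by (simp add: power_mult_distrib)
  then show "AE z in M. norm ((x \<bullet> z) ^ k * exp (- (norm z)\<^sup>2))
      \<le> norm (norm x ^ k * (norm z ^ k * exp (- (norm z)\<^sup>2)))"
    by (intro AE_I2) (simp add: abs_mult power_abs mult.assoc[symmetric])
qed measurable

text \<open>Separates the factor \<open>exp (2 * (x \<bullet> z))\<close>, the only one coupling
  \<open>x\<close> and \<open>z\<close>; its series produces the moments.\<close>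

lemma exp_neg_norm_diff_square:
  fixes x z :: 'a
  shows "exp (- (norm (z - x))\<^sup>2) = exp (- (norm x)\<^sup>2) * (exp (2 * (x \<bullet> z)) * exp (- (norm z)\<^sup>2))"
  by (simp add: exp_add[symmetric] power2_norm_eq_inner inner_diff inner_commute)

lemma exp_inner_gauss_le:
  fixes x z :: 'a
  shows "exp (2 * (x \<bullet> z)) * exp (- (norm z)\<^sup>2) \<le> exp (2 * norm x * norm z) * exp (- (norm z)\<^sup>2)"
  using Cauchy_Schwarz_ineq2[of x z] by simp

lemma integrable_gauss: "integrable M (\<lambda>z. exp (- (norm (z - x))\<^sup>2))"
  unfolding exp_neg_norm_diff_square
  using exp_inner_gauss_le
  by (intro integrable_mult_right Bochner_Integration.integrable_bound
      [OF integrable_exp_norm_gauss[of "2 * norm x"]]) auto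

text \<open>A positive integrand with integral zero would make \<open>M\<close> null, but the unit
  ball about 0 has positive mass.\<close>

lemma gauss_int_pos: "gauss_int 0 > 0"
proof -
  have "gauss_int 0 \<noteq> 0"
  proof
    assume "gauss_int 0 = 0"
    then have "AE z in M. exp (- (norm z)\<^sup>2) = 0"
      using integral_nonneg_eq_0_iff_AE[OF integrable_gauss[of 0]] unfolding gauss_int_def by simp
    then have "AE z in M. False" by simp
    then have "emeasure M (space M) = 0"
      by (simp add: AE_iff_measurable[OF sets.top])
    moreover have "emeasure M (ball 0 1) \<le> emeasure M (space M)"
      by (rule emeasure_space)
    ultimately show False
      using emeasure_ball[OF zero_in_msupport, of 1] c_pos by simp
  qed
  moreover have "gauss_int 0 \<ge> 0"
    unfolding gauss_int_def by simp
  ultimately show ?thesis by simp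
qed

section \<open>Taylor expansion along rays\<close>

text \<open>Termwise integration of the exponential series: by Cauchy-Schwarz all partial sums are
  dominated by \<open>exp (2 * norm x * norm z)\<close>, which is integrable against the Gaussian
  weight.\<close>

lemma sums_moment:
  "(\<lambda>k. 2 ^ k / fact k * moment k x) sums (exp ((norm x)\<^sup>2) * gauss_int x)"
proof -
  let ?w = "\<lambda>z::'a. exp (- (norm z)\<^sup>2)"
  let ?S = "\<lambda>N z. (\<Sum>k<N. (2 * (x \<bullet> z)) ^ k /\<^sub>R fact k) * ?w z"
  have lim: "(\<lambda>N. \<integral>z. ?S N z \<partial>M) \<longlonglongrightarrow> (\<integral>z. exp (2 * (x \<bullet> z)) * ?w z \<partial>M)"
  proof (rule integral_dominated_convergence)
    show "integrable M (\<lambda>z. exp (2 * norm x * norm z) * ?w z)"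
      by (rule integrable_exp_norm_gauss)
    show "AE z in M. (\<lambda>N. ?S N z) \<longlonglongrightarrow> exp (2 * (x \<bullet> z)) * ?w z"
      using exp_converges unfolding sums_def by (intro AE_I2 tendsto_mult_right)
    have "\<bar>\<Sum>k<N. (2 * (x \<bullet> z)) ^ k /\<^sub>R fact k\<bar> \<le> exp (2 * norm x * norm z)" for N z
    proof -
      have "\<bar>\<Sum>k<N. (2 * (x \<bullet> z)) ^ k /\<^sub>R fact k\<bar> \<le> (\<Sum>k<N. \<bar>2 * (x \<bullet> z)\<bar> ^ k /\<^sub>R fact k)"
        by (rule order_trans[OF sum_abs]) (simp add: abs_mult power_abs)
      also have "\<dots> \<le> (\<Sum>k. \<bar>2 * (x \<bullet> z)\<bar> ^ k /\<^sub>R fact k)"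
        by (rule sum_le_suminf) (auto intro!: summable_exp_generic scaleR_nonneg_nonneg simp del: real_scaleR_def)
      also have "\<dots> = exp \<bar>2 * (x \<bullet> z)\<bar>"
        by (simp add: exp_def)
      also have "\<dots> \<le> exp (2 * norm x * norm z)"
        using Cauchy_Schwarz_ineq2[of x z] by (simp add: abs_mult)
      finally show ?thesis .
    qed
    then show "AE z in M. norm (?S N z) \<le> exp (2 * norm x * norm z) * ?w z" for N
      by (intro AE_I2) (simp add: abs_mult)
  qed measurable
  have "(\<integral>z. ?S N z \<partial>M) = (\<Sum>k<N. 2 ^ k / fact k * moment k x)" for N
  proof -
    have "?S N z = (\<Sum>k<N. 2 ^ k / fact k * ((x \<bullet> z) ^ k * ?w z))" for z
      by (simp add: sum_distrib_right sum_distrib_left power_mult_distrib divide_inverse mult_ac)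
    then show ?thesis
      unfolding moment_def using integrable_moment by simp
  qed
  moreover have "(\<integral>z. exp (2 * (x \<bullet> z)) * ?w z \<partial>M) = exp ((norm x)\<^sup>2) * gauss_int x"
    unfolding gauss_int_def exp_neg_norm_diff_square
    by (simp add: exp_minus)
  ultimately show ?thesis
    using lim unfolding sums_def by simp
qed

lemma moment_scaleR: "moment k (t *\<^sub>R x) = t ^ k * moment k x"
  unfolding moment_def by (simp add: power_mult_distrib mult.assoc)

text \<open>Holds for negative \<open>t\<close> as well: the norm contributes
  \<open>\<bar>t\<bar> ^ k\<close> only for even \<open>k\<close>, where it equals
  \<open>t ^ k\<close>.\<close>

lemma taylor_coeff_scaleR: "taylor_coeff k (t *\<^sub>R x) = t ^ k * taylor_coeff k x"
  unfolding taylor_coeff_def moment_scaleR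
  by (auto simp: power_mult_distrib power_even_abs algebra_simps)

lemma sums_taylor_coeff:
  "(\<lambda>k. taylor_coeff k x) sums (exp ((norm x)\<^sup>2) * (gauss_int x - gauss_int 0))"
  unfolding taylor_coeff_def
  using sums_diff[OF sums_moment[of x] sums_mult[OF sums_exp_square[of "norm x"], of "gauss_int 0"]]
  by (simp add: algebra_simps)

text \<open>By homogeneity the series at \<open>t *\<^sub>R x\<close> is a power series in
  \<open>t\<close> with coefficients \<open>taylor_coeff k x\<close>.\<close>

lemma taylor_coeff_eq_0_iff:
  "(\<forall>k. taylor_coeff k x = 0) \<longleftrightarrow> (\<forall>t>0. gauss_int (t *\<^sub>R x) = gauss_int 0)"
proof
  assume "\<forall>k. taylor_coeff k x = 0"
  then have "(\<lambda>k. 0) sums (exp ((norm (t *\<^sub>R x))\<^sup>2) * (gauss_int (t *\<^sub>R x) - gauss_int 0))" for t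
    using sums_taylor_coeff[of "t *\<^sub>R x"] by (simp add: taylor_coeff_scaleR)
  from sums_unique2[OF this sums_zero]
  show "\<forall>t>0. gauss_int (t *\<^sub>R x) = gauss_int 0" by simp
next
  assume zero: "\<forall>t>0. gauss_int (t *\<^sub>R x) = gauss_int 0"
  let ?f = "\<lambda>t. exp ((norm (t *\<^sub>R x))\<^sup>2) * (gauss_int (t *\<^sub>R x) - gauss_int 0)"
  have "(\<lambda>k. taylor_coeff k x * t ^ k) sums ?f t" for t
    using sums_taylor_coeff[of "t *\<^sub>R x"] unfolding taylor_coeff_scaleR by (simp add: mult.commute)
  \<comment> \<open>Both terms of the coefficient are the Gaussian integral centred at the
    origin.\<close>
  moreover have "taylor_coeff 0 x = 0"
    by (simp add: taylor_coeff_def moment_def gauss_int_def)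
  ultimately have "taylor_coeff k x = 0" for k
    by (rule power_series_eq_0) (use zero in simp)
  then show "\<forall>k. taylor_coeff k x = 0" ..
qed

section \<open>Detecting the support by narrow Gaussians\<close>

lemma gauss_int_dilate:
  assumes "r > 0"
  shows "(\<integral>z. exp (- ((norm (z - y))\<^sup>2 / r\<^sup>2)) \<partial>M) = r ^ n * gauss_int (y /\<^sub>R r)"
proof -
  have "(norm (z /\<^sub>R r - y /\<^sub>R r))\<^sup>2 = (norm (z - y))\<^sup>2 / r\<^sup>2" for z
    using assms by (simp add: scaleR_diff_right[symmetric] power_mult_distrib divide_inverse
        power_inverse mult.commute)
  then have "(\<integral>z. exp (- ((norm (z - y))\<^sup>2 / r\<^sup>2)) \<partial>M) =
      (\<integral>z. exp (- (norm (z - y /\<^sub>R r))\<^sup>2) \<partial>dilated_measure r M)"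
    unfolding dilated_measure_def by (subst integral_distr) auto
  also have "\<dots> = r ^ n * gauss_int (y /\<^sub>R r)"
    unfolding dilated[OF assms] gauss_int_def
    using assms by (subst (1 2) integral_eq_nn_integral)
      (auto simp: nn_integral_scale_measure enn2real_mult)
  finally show ?thesis .
qed

text \<open>If a ball around \<open>y\<close> were null, Gaussians of width \<open>1 / k\<close>
  centred at \<open>y\<close> would have exponentially small integrals, while
  \<open>gauss_int_dilate\<close> and \<open>const\<close> keep these at
  \<open>gauss_int 0 / k ^ n\<close>.\<close>

lemma in_msupport_if_gauss_int:
  assumes const: "\<And>t. t > 0 \<Longrightarrow> gauss_int (t *\<^sub>R y) = gauss_int 0"
  shows "y \<in> msupport M"
proof (rule ccontr)
  assume "y \<notin> msupport M"
  then obtain e where e: "e > 0" "emeasure M (ball y e) = 0"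
    by (auto simp: msupport_def)
  then have far: "AE z in M. norm (z - y) \<ge> e"
    by (intro AE_I'[of "ball y e"]) (auto simp: null_sets_def sets_M dist_norm norm_minus_commute)
  have bound: "1 \<le> real k ^ n * exp (- e\<^sup>2 * ((real k)\<^sup>2 - 1))" if "k \<ge> 1" for k :: nat
  proof -
    define r where "r = 1 / real k"
    have "r > 0" using that by (simp add: r_def)
    have "r ^ n * gauss_int 0 = (\<integral>z. exp (- ((norm (z - y))\<^sup>2 / r\<^sup>2)) \<partial>M)"
      using gauss_int_dilate[OF \<open>r > 0\<close>] const[of "inverse r"] \<open>r > 0\<close> by simp
    also have "\<dots> \<le> (\<integral>z. exp (- e\<^sup>2 * ((real k)\<^sup>2 - 1)) * exp (- (norm (z - y))\<^sup>2) \<partial>M)"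
    proof (rule integral_mono_AE')
      show "integrable M (\<lambda>z. exp (- e\<^sup>2 * ((real k)\<^sup>2 - 1)) * exp (- (norm (z - y))\<^sup>2))"
        by (intro integrable_mult_right integrable_gauss)
      show "AE z in M. exp (- ((norm (z - y))\<^sup>2 / r\<^sup>2))
          \<le> exp (- e\<^sup>2 * ((real k)\<^sup>2 - 1)) * exp (- (norm (z - y))\<^sup>2)"
        using far
      proof eventually_elim
        case (elim z)
        \<comment> \<open>Only the excess \<open>k\<^sup>2 - 1\<close> of the exponent is estimated;
          the remaining unit Gaussian keeps the majorant integrable.\<close>
        then have "e\<^sup>2 * ((real k)\<^sup>2 - 1) \<le> (norm (z - y))\<^sup>2 * ((real k)\<^sup>2 - 1)"
          using e that by (intro mult_right_mono power_mono) auto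
        then show ?case
          by (simp add: exp_add[symmetric] r_def field_simps)
      qed
    qed simp
    also have "\<dots> = exp (- e\<^sup>2 * ((real k)\<^sup>2 - 1)) * gauss_int 0"
      \<comment> \<open>At \<open>t = 1\<close> the unit Gaussian integral at \<open>y\<close> is
        \<open>gauss_int 0\<close>, so this positive factor cancels from both sides.\<close>
      using const[of 1] by (simp add: gauss_int_def)
    finally have "r ^ n \<le> exp (- e\<^sup>2 * ((real k)\<^sup>2 - 1))"
      using gauss_int_pos by simp
    then show ?thesis
      using that by (simp add: r_def power_divide field_simps)
  qed
  have "(\<lambda>k. real k ^ n * exp (- e\<^sup>2 * ((real k)\<^sup>2 - 1))) \<longlonglongrightarrow> 0"
    using \<open>e > 0\<close> by real_asymp
  then have "1 \<le> (0::real)"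
    by (rule LIMSEQ_le_const) (use bound in auto)
  then show False by simp
qed

section \<open>The support as a symmetric algebraic variety\<close>

lemma msupport_eq_taylor_coeff: "msupport M = {x. \<forall>k. taylor_coeff k x = 0}"
  using taylor_coeff_eq_0_iff in_msupport_if_gauss_int gauss_int_msupport scaleR_in_msupport
  by blast

lemma real_polynomial_function_taylor_coeff: "real_polynomial_function (taylor_coeff k)"
proof -
  have "real_polynomial_function (\<lambda>x::'a. if even k then norm x ^ k / fact (k div 2) else 0)"
  proof (cases "even k")
    case True
    \<comment> \<open>Evenness of \<open>k\<close> matters here: even powers of the norm are powers
      of the sum of squares.\<close>
    then have "norm x ^ k = (\<Sum>b\<in>Basis. (x \<bullet> b) * (x \<bullet> b)) ^ (k div 2)" for x :: 'a
      by (simp add: power_mult[symmetric] euclidean_inner[symmetric] power2_norm_eq_inner[symmetric])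
    moreover have "real_polynomial_function (\<lambda>x::'a. (\<Sum>b\<in>Basis. (x \<bullet> b) * (x \<bullet> b)) ^ (k div 2))"
      by (intro real_polynomial_function_power real_polynomial_function_sum
          real_polynomial_function.intros(4) real_polynomial_function.intros(1) bounded_linear_inner_left) auto
    ultimately show ?thesis
      using True by (simp add: real_polynomial_function_divide)
  qed (simp add: real_polynomial_function.intros(2))
  moreover have "real_polynomial_function (moment k)"
    unfolding moment_def using sets_M integrable_norm_power_gauss
    by (intro real_polynomial_function_inner_moment) auto
  ultimately show ?thesis
    unfolding taylor_coeff_def
    by (intro real_polynomial_function_diff real_polynomial_function.intros(4)
        real_polynomial_function.intros(2))
qed

lemma algebraic_variety_msupport: "algebraic_variety (msupport M)"
  unfolding algebraic_variety_def
  using real_polynomial_function_taylor_coeff msupport_eq_taylor_coeff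
  by (intro exI[of _ "range taylor_coeff"]) auto

lemma msupport_symmetric: "msupport M = uminus ` msupport M"
proof -
  \<comment> \<open>Homogeneity at \<open>t = - 1\<close> changes each coefficient only by a
    sign.\<close>
  have "- x \<in> msupport M" if "x \<in> msupport M" for x
    using that taylor_coeff_scaleR[of _ "- 1" x] unfolding msupport_eq_taylor_coeff by simp
  then show ?thesis
    by force
qed

end

theorem theorem1p4:
  fixes n :: nat and \<nu> :: "(real ^ 'd) measure"
  assumes "conical_uniform_measure n \<nu>"
  shows "algebraic_variety (msupport \<nu>) \<and> msupport \<nu> = uminus ` msupport \<nu>"
proof (cases "msupport \<nu> = {}")
  case True
  \<comment> \<open>The zero measure has empty support; a nonzero constant polynomial has no
    zeros.\<close>
  moreover have "algebraic_variety ({} :: (real ^ 'd) set)"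
    unfolding algebraic_variety_def
    by (intro exI[of _ "{\<lambda>_. 1}"]) (simp add: real_polynomial_function.intros(2))
  ultimately show ?thesis by simp
next
  case False
  have "uniform_measure_dim n \<nu>"
    and "\<And>r. r > 0 \<Longrightarrow> dilated_measure r \<nu> = scale_measure (ennreal (r ^ n)) \<nu>"
    using assms unfolding conical_uniform_measure_def by simp_all
  moreover from this(1) have "sets \<nu> = sets borel"
    by (simp add: uniform_measure_dim_def radon_measure_def)
  moreover from \<open>uniform_measure_dim n \<nu>\<close> obtain c where "c > 0"
    "\<And>x r. x \<in> msupport \<nu> \<Longrightarrow> r > 0 \<Longrightarrow> emeasure \<nu> (ball x r) = ennreal (c * r ^ n)"
    unfolding uniform_measure_dim_def by auto
  ultimately have "conical_uniform \<nu> n c"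
    using False by unfold_locales
  then interpret conical_uniform \<nu> n c .
  show ?thesis
    using algebraic_variety_msupport msupport_symmetric by (rule conjI)
qed

end
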